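(* For every positive integer $n$, the set of fb-tableaux of size $n$ endowed with the relation $\lhd$ is a self-dual lattice (i.e. $\lhd$ is a partial order in which any two elements have a meet and a join, and this lattice is isomorphic to its opposite).
   Context: Let $n$ be a positive integer. The board of size $n$ is the Ferrers diagram of shape $(n,n,n-1,n-2,\dots,3,2)$ (a single cell $(1,1)$ if $n=1$). Its cells are written $(i,j)$, where $i$ is the row, numbered from the top, and $j$ is the column label, the columns being labelled $n,n-1,\dots,1$ from left to right. So the cells are $(1,j)$ for $1\le j\le n$ and $(i,j)$ for $2\le i\le n$, $i-1\le j\le n$. The root is $(1,n)$ (top-left cell); the border cells are $(i,i-1)$ for $2\le i\le n$ (the rightmost cells of rows $2,\dots,n$). An fb-tableau of size $n$ is a filling in which each cell is either empty or nonempty such that the root and all border cells are nonempty, and every nonempty cell other than the root has a nonempty cell strictly to its left in the same row or strictly above it in the same column. In an fb-tableau, a nonempty cell different from the root is called a left-arrow if there is no nonempty cell strictly to its left in its row, an up-arrow if there is no nonempty cell strictly above it in its column, and a dot otherwise; the root is also a dot. (Each of rows $2,\dots,n$ has exactly one left-arrow, each of columns $1,\dots,n-1$ has exactly one up-arrow.) A cell is free in $T$ if it lies strictly below an up-arrow (same column) and strictly to the right of a left-arrow (same row); a free cell is either empty or contains a dot. $\operatorname{Row}(T)$ is the set of cells lying weakly to the right of a left-arrow or of the root in the same row; $\operatorname{Col}(T)$ is the set of cells lying weakly below an up-arrow or the root in the same column. For fb-tableaux $S,T$ of size $n$, write $S\lhd T$ if (1) $\operatorname{Col}(S)\subseteq\operatorname{Col}(T)$;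 (2) $\operatorname{Row}(T)\subseteq\operatorname{Row}(S)$; (3) for every cell $c$ that is free in both $S$ and $T$, if $c$ contains a dot in $S$ then $c$ contains a dot in $T$. *)

theory Defs
  imports "HOL-Algebra.Lattice"
begin

text \<open>
  A cell is a pair (row, column label). Rows are numbered from the top, but column labels
  decrease from left to right: a larger label means further to the left.
\<close>

type_synonym cell = "nat \<times> nat"

definition board :: "nat \<Rightarrow> cell set" where
  "board n = {(1, j) | j. 1 \<le> j \<and> j \<le> n} \<union> {(i, j) | i j. 2 \<le> i \<and> i \<le> n \<and> i - 1 \<le> j \<and> j \<le> n}"

definition root :: "nat \<Rightarrow> cell" where
  "root n = (1, n)"

definition border :: "nat \<Rightarrow> cell set" where
  "border n = {(i, i - 1) | i. 2 \<le> i \<and> i \<le> n}"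

definition left_of :: "cell \<Rightarrow> cell \<Rightarrow> bool" where
  "left_of d c \<longleftrightarrow> fst d = fst c \<and> snd d > snd c"

definition above :: "cell \<Rightarrow> cell \<Rightarrow> bool" where
  "above d c \<longleftrightarrow> snd d = snd c \<and> fst d < fst c"

text \<open>A filling of the board is identified with its set of nonempty cells.\<close>

definition fb_tableau :: "nat \<Rightarrow> cell set \<Rightarrow> bool" where
  "fb_tableau n T \<longleftrightarrow>
     T \<subseteq> board n \<and> root n \<in> T \<and> border n \<subseteq> T \<and>
     (\<forall>c \<in> T - {root n}. \<exists>d \<in> T. left_of d c \<or> above d c)"

definition left_arrows :: "nat \<Rightarrow> cell set \<Rightarrow> cell set" where
  "left_arrows n T = {c \<in> T - {root n}. \<not> (\<exists>d \<in> T. left_of d c)}"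

definition up_arrows :: "nat \<Rightarrow> cell set \<Rightarrow> cell set" where
  "up_arrows n T = {c \<in> T - {root n}. \<not> (\<exists>d \<in> T. above d c)}"

definition dots :: "nat \<Rightarrow> cell set \<Rightarrow> cell set" where
  "dots n T = T - left_arrows n T - up_arrows n T"

definition free_cells :: "nat \<Rightarrow> cell set \<Rightarrow> cell set" where
  "free_cells n T =
     {c \<in> board n. (\<exists>u \<in> up_arrows n T. above u c) \<and> (\<exists>l \<in> left_arrows n T. left_of l c)}"

definition Row :: "nat \<Rightarrow> cell set \<Rightarrow> cell set" where
  "Row n T = {c \<in> board n. \<exists>d \<in> left_arrows n T \<union> {root n}. d = c \<or> left_of d c}"

definition Col :: "nat \<Rightarrow> cell set \<Rightarrow> cell set" where
  "Col n T = {c \<in> board n. \<exists>d \<in> up_arrows n T \<union> {root n}. d = c \<or> above d c}"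

definition fb_le :: "nat \<Rightarrow> cell set \<Rightarrow> cell set \<Rightarrow> bool" where
  "fb_le n S T \<longleftrightarrow>
     Col n S \<subseteq> Col n T \<and> Row n T \<subseteq> Row n S \<and>
     (\<forall>c \<in> free_cells n S \<inter> free_cells n T. c \<in> dots n S \<longrightarrow> c \<in> dots n T)"

definition fb_order :: "nat \<Rightarrow> cell set gorder" where
  "fb_order n = \<lparr>carrier = {T. fb_tableau n T}, eq = (=), le = fb_le n\<rparr>"

definition order_isomorphic :: "'a gorder \<Rightarrow> 'b gorder \<Rightarrow> bool" where
  "order_isomorphic A B \<longleftrightarrow>
     (\<exists>f. bij_betw f (carrier A) (carrier B) \<and> order_emb A B f)"

end

theory Submission
  imports Defs
begin

text \<open>A tableau amounts to the column \<open>l i\<close> of the left-arrow of every row, the row \<open>u j\<close> of the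
  up-arrow of every column and a set of free cells containing the free border cells. The arrows
  are subject to \<open>u (l i) < i\<close> and \<open>j < l (u j)\<close> only, and \<open>S \<lhd> T\<close> says that \<open>l\<close> and \<open>u\<close> decrease
  from \<open>S\<close> to \<open>T\<close> while the dots on common free cells increase. The arrows of a least upper bound
  are the largest admissible ones below both pairs; its dots are those inherited from \<open>S\<close> or \<open>T\<close>,
  together with the free border cells. Reflection composed with complementation of the free cells
  off the border is an order-reversing involution, which also turns joins into meets.\<close>

section \<open>Arrow coordinates and tableaux built from them\<close>

definition leftmost :: "cell set \<Rightarrow> nat \<Rightarrow> nat" where
  "leftmost T i = Max {j. (i, j) \<in> T}"

definition topmost :: "cell set \<Rightarrow> nat \<Rightarrow> nat" where
  "topmost T j = Min {i. (i, j) \<in> T}"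

text \<open>With \<open>l 1 = n\<close> and \<open>u n = 1\<close> the root is treated as the left-arrow of row 1 and the
  up-arrow of column \<open>n\<close>, so that most conditions need no case distinction.\<close>

definition arrow_system :: "nat \<Rightarrow> (nat \<Rightarrow> nat) \<Rightarrow> (nat \<Rightarrow> nat) \<Rightarrow> bool" where
  "arrow_system n l u \<longleftrightarrow> l 1 = n \<and> u n = 1 \<and>
     (\<forall>i. 2 \<le> i \<and> i \<le> n \<longrightarrow> i \<le> l i + 1 \<and> l i \<le> n \<and> u (l i) < i) \<and>
     (\<forall>j. 1 \<le> j \<and> j < n \<longrightarrow> 1 \<le> u j \<and> u j \<le> j + 1 \<and> j < l (u j))"

text \<open>\<open>D\<close> may be any set: only its cells strictly beyond both arrows are used. A
  border cell satisfies \<open>j <= l i\<close> and \<open>u j <= i\<close>, so it is an arrow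
  position or is free; the disjunct \<open>i = j + 1\<close> fills it in the latter case.\<close>

definition tableau_of :: "nat \<Rightarrow> (nat \<Rightarrow> nat) \<Rightarrow> (nat \<Rightarrow> nat) \<Rightarrow> cell set \<Rightarrow> cell set" where
  "tableau_of n l u D = {(i, j) \<in> board n. j = l i \<or> i = u j \<or>
     (j < l i \<and> u j < i \<and> (i = j + 1 \<or> (i, j) \<in> D))}"

lemma board_iff: "(i, j) \<in> board n \<longleftrightarrow> 1 \<le> i \<and> i \<le> n \<and> 1 \<le> j \<and> j \<le> n \<and> i \<le> j + 1"
  unfolding board_def by auto

lemma border_iff: "(i, j) \<in> border n \<longleftrightarrow> 2 \<le> i \<and> i \<le> n \<and> i = j + 1"
  unfolding border_def by auto

text \<open>The weak bounds extend to row 1 and column \<open>n\<close>. The two strict conditions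
  cannot: at the root they would read \<open>1 < 1\<close> and \<open>n < n\<close>.\<close>

lemma arrow_systemD:
  assumes "arrow_system n l u"
  shows "l 1 = n" "u n = 1"
    "\<And>i. 1 \<le> i \<Longrightarrow> i \<le> n \<Longrightarrow> i \<le> l i + 1 \<and> 1 \<le> l i \<and> l i \<le> n"
    "\<And>j. 1 \<le> j \<Longrightarrow> j \<le> n \<Longrightarrow> 1 \<le> u j \<and> u j \<le> j + 1 \<and> u j \<le> n"
    "\<And>i. 2 \<le> i \<Longrightarrow> i \<le> n \<Longrightarrow> u (l i) < i"
    "\<And>j. 1 \<le> j \<Longrightarrow> j < n \<Longrightarrow> j < l (u j)"
proof -
  show "l 1 = n" "u n = 1" using assms by (auto simp: arrow_system_def)
  show "i \<le> l i + 1 \<and> 1 \<le> l i \<and> l i \<le> n" if "1 \<le> i" "i \<le> n" for i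
  proof (cases "i = 1")
    case False
    then have "2 \<le> i" "i \<le> l i + 1" "l i \<le> n"
      using assms that by (auto simp: arrow_system_def)
    then show ?thesis by simp
  qed (use assms that in \<open>auto simp: arrow_system_def\<close>)
  show "1 \<le> u j \<and> u j \<le> j + 1 \<and> u j \<le> n" if "1 \<le> j" "j \<le> n" for j
    using assms that by (cases "j = n") (fastforce simp: arrow_system_def)+
  show "u (l i) < i" if "2 \<le> i" "i \<le> n" for i
    using assms that by (auto simp: arrow_system_def)
  show "j < l (u j)" if "1 \<le> j" "j < n" for j
    using assms that by (auto simp: arrow_system_def)
qed

lemma finite_row: "T \<subseteq> board n \<Longrightarrow> finite {j. (i, j) \<in> T}"
  by (rule finite_subset[of _ "{..n}"]) (auto simp: board_iff dest!: subsetD)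

lemma finite_column: "T \<subseteq> board n \<Longrightarrow> finite {i. (i, j) \<in> T}"
  by (rule finite_subset[of _ "{..n}"]) (auto simp: board_iff dest!: subsetD)

lemma leftmostI:
  assumes "T \<subseteq> board n" "(i, j) \<in> T" "\<And>k. (i, k) \<in> T \<Longrightarrow> k \<le> j"
  shows "leftmost T i = j"
  unfolding leftmost_def
proof (rule Max_eqI)
  show "finite {j. (i, j) \<in> T}" using finite_row[OF assms(1)] .
qed (use assms in auto)

lemma topmostI:
  assumes "T \<subseteq> board n" "(i, j) \<in> T" "\<And>k. (k, j) \<in> T \<Longrightarrow> i \<le> k"
  shows "topmost T j = i"
  unfolding topmost_def
proof (rule Min_eqI)
  show "finite {i. (i, j) \<in> T}" using finite_column[OF assms(1)] .
qed (use assms in auto)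

lemma leftmost_greatest:
  assumes "T \<subseteq> board n" "(i, j) \<in> T"
  shows "(i, leftmost T i) \<in> T" "j \<le> leftmost T i"
proof -
  note fin = finite_row[OF assms(1), of i]
  show "(i, leftmost T i) \<in> T" "j \<le> leftmost T i"
    using Max_in[OF fin] Max_ge[OF fin, of j] assms(2) by (auto simp: leftmost_def)
qed

lemma topmost_least:
  assumes "T \<subseteq> board n" "(i, j) \<in> T"
  shows "(topmost T j, j) \<in> T" "topmost T j \<le> i"
proof -
  note fin = finite_column[OF assms(1), of j]
  show "(topmost T j, j) \<in> T" "topmost T j \<le> i"
    using Min_in[OF fin] Min_le[OF fin, of i] assms(2) by (auto simp: topmost_def)
qed

section \<open>From arrow systems to tableaux and back\<close>

lemma tableau_of:
  assumes ls: "arrow_system n l u" and n: "n \<ge> 1"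
  shows fb_tableau_tableau_of: "fb_tableau n (tableau_of n l u D)"
    and leftmost_tableau_of: "1 \<le> i \<Longrightarrow> i \<le> n \<Longrightarrow> leftmost (tableau_of n l u D) i = l i"
    and topmost_tableau_of: "1 \<le> j \<Longrightarrow> j \<le> n \<Longrightarrow> topmost (tableau_of n l u D) j = u j"
proof -
  note A = arrow_systemD[OF ls]
  let ?T = "tableau_of n l u D"
  have sub: "?T \<subseteq> board n" by (auto simp: tableau_of_def)
  have lin: "(i, l i) \<in> ?T" if "1 \<le> i" "i \<le> n" for i
    using A(3)[OF that] that by (simp add: tableau_of_def board_iff)
  have uin: "(u j, j) \<in> ?T" if "1 \<le> j" "j \<le> n" for j
    using A(4)[OF that] that by (simp add: tableau_of_def board_iff)
  \<comment> \<open>An up-arrow at \<open>(u j, j)\<close> cannot stick out to the left of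
    \<open>l\<close> in its row, because \<open>j < l (u j)\<close>. Symmetrically,
    \<open>u (l i) < i\<close> keeps left-arrows below the up-arrows in \<open>umin\<close>.\<close>
  have lmax: "j \<le> l i" if "(i, j) \<in> ?T" for i j
    using that A(1,2) A(6)[of j] by (cases "j = n") (auto simp: tableau_of_def board_iff)
  have umin: "u j \<le> i" if "(i, j) \<in> ?T" for i j
    using that A(1,2) A(5)[of i] by (cases "i = 1") (auto simp: tableau_of_def board_iff)
  show "1 \<le> i \<Longrightarrow> i \<le> n \<Longrightarrow> leftmost ?T i = l i" for i
    by (rule leftmostI[OF sub lin]) (auto intro: lmax)
  show "1 \<le> j \<Longrightarrow> j \<le> n \<Longrightarrow> topmost ?T j = u j" for j
    by (rule topmostI[OF sub uin]) (auto intro: umin)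
  have "root n \<in> ?T"
    using lin[of 1] A(1) n by (simp add: root_def)
  moreover have "(i, j) \<in> ?T" if "(i, j) \<in> border n" for i j
  proof -
    have ij: "2 \<le> i" "i \<le> n" "i = j + 1" using that by (auto simp: border_iff)
    then have "j \<le> l i" "u j \<le> i" using A(3)[of i] A(4)[of j] by auto
    then show ?thesis using ij by (auto simp: tableau_of_def board_iff)
  qed
  moreover have "\<exists>d\<in>?T. left_of d (i, j) \<or> above d (i, j)"
    if "(i, j) \<in> ?T" "(i, j) \<noteq> root n" for i j
  proof (cases "j < l i")
    case True
    then show ?thesis using lin[of i] that sub
      by (intro bexI[of _ "(i, l i)"]) (auto simp: left_of_def board_iff)
  next
    case False
    \<comment> \<open>The cell is the left-arrow of its row, so its support has to come from above;
      the up-arrow of its column lies there since \<open>u (l i) < i\<close>.\<close>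
    then have j: "j = l i" using lmax[OF that(1)] by simp
    have b: "1 \<le> i" "i \<le> n" "1 \<le> j" "j \<le> n" using that sub by (auto simp: board_iff)
    then have "2 \<le> i" using that(2) j A(1) by (cases "i = 1") (auto simp: root_def)
    then show ?thesis using A(5)[of i] b j uin[of j]
      by (intro bexI[of _ "(u j, j)"]) (auto simp: above_def)
  qed
  ultimately show "fb_tableau n ?T"
    using sub unfolding fb_tableau_def by auto
qed

text \<open>The root and the border cells make every row and column nonempty, so the extremal cells
  exist. Apart from the root, these are exactly the arrows.\<close>

lemma fb_tableau_arrows:
  assumes T: "fb_tableau n T" and n: "n \<ge> 1"
  shows left_arrows_eq: "left_arrows n T = {(i, leftmost T i) | i. 2 \<le> i \<and> i \<le> n}"
    and up_arrows_eq: "up_arrows n T = {(topmost T j, j) | j. 1 \<le> j \<and> j < n}"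
    and arrow_system_fb_tableau: "arrow_system n (leftmost T) (topmost T)"
    and leftmost_ge: "(i, j) \<in> T \<Longrightarrow> j \<le> leftmost T i"
    and topmost_le: "(i, j) \<in> T \<Longrightarrow> topmost T j \<le> i"
    and leftmost_in: "1 \<le> i \<Longrightarrow> i \<le> n \<Longrightarrow> (i, leftmost T i) \<in> T"
    and topmost_in: "1 \<le> j \<Longrightarrow> j \<le> n \<Longrightarrow> (topmost T j, j) \<in> T"
proof -
  have sub: "T \<subseteq> board n" and root: "(1, n) \<in> T" and bord: "border n \<subseteq> T"
    and arr: "\<And>i j. (i, j) \<in> T \<Longrightarrow> (i, j) \<noteq> (1, n) \<Longrightarrow> \<exists>d\<in>T. left_of d (i, j) \<or> above d (i, j)"
    using T by (auto simp: fb_tableau_def root_def)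
  have bounds: "1 \<le> i \<and> i \<le> n \<and> 1 \<le> j \<and> j \<le> n \<and> i \<le> j + 1" if "(i, j) \<in> T" for i j
    using that sub by (auto simp: board_iff)
  have row: "\<exists>j. (i, j) \<in> T" if "1 \<le> i" "i \<le> n" for i
  proof (cases "i = 1")
    case False
    then have "(i, i - 1) \<in> border n" using that by (auto simp: border_iff)
    then show ?thesis using bord by blast
  qed (use root in auto)
  have col: "\<exists>i. (i, j) \<in> T" if "1 \<le> j" "j \<le> n" for j
  proof (cases "j = n")
    case False
    then have "(j + 1, j) \<in> border n" using that by (auto simp: border_iff)
    then show ?thesis using bord by blast
  qed (use root in auto)
  show lin: "(i, leftmost T i) \<in> T" if "1 \<le> i" "i \<le> n" for i
    using row[OF that] leftmost_greatest[OF sub] by auto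
  show uin: "(topmost T j, j) \<in> T" if "1 \<le> j" "j \<le> n" for j
    using col[OF that] topmost_least[OF sub] by auto
  show lge: "j \<le> leftmost T i" if "(i, j) \<in> T" for i j
    using leftmost_greatest[OF sub that] by simp
  show ule: "topmost T j \<le> i" if "(i, j) \<in> T" for i j
    using topmost_least[OF sub that] by simp
  have l1: "leftmost T 1 = n"
    using lge[OF root] bounds[OF lin[of 1]] n by simp
  have un: "topmost T n = 1"
    using ule[OF root] bounds[OF uin[of n]] n by simp
  show "left_arrows n T = {(i, leftmost T i) | i. 2 \<le> i \<and> i \<le> n}"
  proof (intro Set.set_eqI iffI)
    fix c assume c: "c \<in> left_arrows n T"
    obtain i j where [simp]: "c = (i, j)" by fastforce
    have ij: "(i, j) \<in> T" "(i, j) \<noteq> (1, n)" "\<And>k. (i, k) \<in> T \<Longrightarrow> k \<le> j"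
      using c by (auto simp: left_arrows_def root_def left_of_def not_less)
    have "leftmost T i = j" using leftmostI[OF sub ij(1,3)] .
    moreover have "i \<noteq> 1" using ij(2) l1 calculation by auto
    ultimately show "c \<in> {(i, leftmost T i) | i. 2 \<le> i \<and> i \<le> n}"
      using bounds[OF ij(1)] by auto
  next
    fix c assume "c \<in> {(i, leftmost T i) | i. 2 \<le> i \<and> i \<le> n}"
    then show "c \<in> left_arrows n T"
      using lin lge by (fastforce simp: left_arrows_def root_def left_of_def)
  qed
  show "up_arrows n T = {(topmost T j, j) | j. 1 \<le> j \<and> j < n}"
  proof (intro Set.set_eqI iffI)
    fix c assume c: "c \<in> up_arrows n T"
    obtain i j where [simp]: "c = (i, j)" by fastforce
    have ij: "(i, j) \<in> T" "(i, j) \<noteq> (1, n)" "\<And>k. (k, j) \<in> T \<Longrightarrow> i \<le> k"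
      using c by (auto simp: up_arrows_def root_def above_def not_less)
    have "topmost T j = i" using topmostI[OF sub ij(1,3)] .
    moreover have "j \<noteq> n" using ij(2) un calculation by auto
    ultimately show "c \<in> {(topmost T j, j) | j. 1 \<le> j \<and> j < n}"
      using bounds[OF ij(1)] by auto
  next
    fix c assume "c \<in> {(topmost T j, j) | j. 1 \<le> j \<and> j < n}"
    then show "c \<in> up_arrows n T"
      using uin ule by (fastforce simp: up_arrows_def root_def above_def)
  qed
  \<comment> \<open>Nothing lies to the left of a leftmost cell, so its supporting cell lies above
    it. The condition for up-arrows follows in the same way.\<close>
  have "topmost T (leftmost T i) < i" if i: "2 \<le> i" "i \<le> n" for i
  proof -
    obtain a b where d: "(a, b) \<in> T" "left_of (a, b) (i, leftmost T i) \<or> above (a, b) (i, leftmost T i)"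
      using arr[OF lin[of i]] i by fastforce
    then have "b = leftmost T i" "a < i"
      using lge[OF d(1)] by (auto simp: left_of_def above_def)
    then show ?thesis using ule[OF d(1)] by simp
  qed
  moreover have "j < leftmost T (topmost T j)" if j: "1 \<le> j" "j < n" for j
  proof -
    obtain a b where d: "(a, b) \<in> T" "left_of (a, b) (topmost T j, j) \<or> above (a, b) (topmost T j, j)"
      using arr[OF uin[of j]] j by fastforce
    then have "a = topmost T j" "j < b"
      using ule[OF d(1)] by (auto simp: left_of_def above_def)
    then show ?thesis using lge[OF d(1)] by simp
  qed
  ultimately show "arrow_system n (leftmost T) (topmost T)"
    unfolding arrow_system_def using l1 un bounds[OF lin] bounds[OF uin] by auto
qed

section \<open>The order in coordinates\<close>

lemma Row_iff:
  assumes "fb_tableau n T" "n \<ge> 1"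
  shows "(i, j) \<in> Row n T \<longleftrightarrow> (i, j) \<in> board n \<and> j \<le> leftmost T i"
  using arrow_systemD(1)[OF arrow_system_fb_tableau[OF assms]]
  by (cases "i = 1") (auto simp: Row_def left_arrows_eq[OF assms] root_def left_of_def board_iff
      intro!: exI[of _ i])

lemma Col_iff:
  assumes "fb_tableau n T" "n \<ge> 1"
  shows "(i, j) \<in> Col n T \<longleftrightarrow> (i, j) \<in> board n \<and> topmost T j \<le> i"
  using arrow_systemD(2)[OF arrow_system_fb_tableau[OF assms]]
  by (cases "j = n") (auto simp: Col_def up_arrows_eq[OF assms] root_def above_def board_iff)

text \<open>The root is an extremal cell but not an arrow, which causes no discrepancy:
  \<open>topmost T j < i\<close> forces \<open>i >= 2\<close>, and \<open>j < leftmost T i\<close>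
  forces \<open>j < n\<close>.\<close>

lemma free_cells_iff:
  assumes "fb_tableau n T" "n \<ge> 1"
  shows "(i, j) \<in> free_cells n T \<longleftrightarrow> (i, j) \<in> board n \<and> j < leftmost T i \<and> topmost T j < i"
  using arrow_systemD(3,4)[OF arrow_system_fb_tableau[OF assms], of i]
    arrow_systemD(4)[OF arrow_system_fb_tableau[OF assms], of j]
  by (auto simp: free_cells_def left_arrows_eq[OF assms] up_arrows_eq[OF assms] above_def
      left_of_def board_iff)

lemma dots_free_iff:
  assumes "fb_tableau n T" "n \<ge> 1" "c \<in> free_cells n T"
  shows "c \<in> dots n T \<longleftrightarrow> c \<in> T"
  using assms(3)
  by (cases c) (auto simp: free_cells_iff[OF assms(1,2)] dots_def left_arrows_eq[OF assms(1,2)]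
      up_arrows_eq[OF assms(1,2)])

text \<open>In each row, \<open>Row\<close> is a segment whose left end is the leftmost cell, so
  inclusion is a comparison of end points; the same holds for \<open>Col\<close> in each column.
  Condition (3) can use plain membership because a free cell is never an arrow.\<close>

lemma fb_le_iff:
  assumes S: "fb_tableau n S" and T: "fb_tableau n T" and n: "n \<ge> 1"
  shows "fb_le n S T \<longleftrightarrow>
     (\<forall>i. 1 \<le> i \<and> i \<le> n \<longrightarrow> leftmost T i \<le> leftmost S i) \<and>
     (\<forall>j. 1 \<le> j \<and> j \<le> n \<longrightarrow> topmost T j \<le> topmost S j) \<and>
     (\<forall>i j. (i, j) \<in> free_cells n S \<and> (i, j) \<in> free_cells n T \<and> (i, j) \<in> S \<longrightarrow> (i, j) \<in> T)"
proof -
  note AS = arrow_systemD(3,4)[OF arrow_system_fb_tableau[OF S n]]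
  note AT = arrow_systemD(3,4)[OF arrow_system_fb_tableau[OF T n]]
  have "Col n S \<subseteq> Col n T \<longleftrightarrow> (\<forall>j. 1 \<le> j \<and> j \<le> n \<longrightarrow> topmost T j \<le> topmost S j)"
  proof
    assume sub: "Col n S \<subseteq> Col n T"
    show "\<forall>j. 1 \<le> j \<and> j \<le> n \<longrightarrow> topmost T j \<le> topmost S j"
    proof (intro allI impI)
      fix j assume "1 \<le> j \<and> j \<le> n"
      then have "(topmost S j, j) \<in> Col n S" using AS(2)[of j] by (simp add: Col_iff[OF S n] board_iff)
      then show "topmost T j \<le> topmost S j" using sub by (auto simp: Col_iff[OF T n])
    qed
  next
    assume "\<forall>j. 1 \<le> j \<and> j \<le> n \<longrightarrow> topmost T j \<le> topmost S j"
    then show "Col n S \<subseteq> Col n T"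
      by (fastforce simp: Col_iff[OF T n] Col_iff[OF S n] board_iff)
  qed
  moreover have "Row n T \<subseteq> Row n S \<longleftrightarrow> (\<forall>i. 1 \<le> i \<and> i \<le> n \<longrightarrow> leftmost T i \<le> leftmost S i)"
  proof
    assume sub: "Row n T \<subseteq> Row n S"
    show "\<forall>i. 1 \<le> i \<and> i \<le> n \<longrightarrow> leftmost T i \<le> leftmost S i"
    proof (intro allI impI)
      fix i assume "1 \<le> i \<and> i \<le> n"
      then have "(i, leftmost T i) \<in> Row n T" using AT(1)[of i] by (simp add: Row_iff[OF T n] board_iff)
      then show "leftmost T i \<le> leftmost S i" using sub by (auto simp: Row_iff[OF S n])
    qed
  next
    assume "\<forall>i. 1 \<le> i \<and> i \<le> n \<longrightarrow> leftmost T i \<le> leftmost S i"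
    then show "Row n T \<subseteq> Row n S"
      by (fastforce simp: Row_iff[OF T n] Row_iff[OF S n] board_iff)
  qed
  ultimately show ?thesis
    unfolding fb_le_def using dots_free_iff[OF S n] dots_free_iff[OF T n] by auto
qed

text \<open>A nonempty cell is leftmost in its row, topmost in its column, or free. Applied in both
  directions, this gives the equalities needed for antisymmetry and for the involution.\<close>

lemma fb_tableau_subset:
  assumes S: "fb_tableau n S" and T: "fb_tableau n T" and n: "n \<ge> 1"
    and l: "\<And>i. 1 \<le> i \<Longrightarrow> i \<le> n \<Longrightarrow> leftmost S i = leftmost T i"
    and u: "\<And>j. 1 \<le> j \<Longrightarrow> j \<le> n \<Longrightarrow> topmost S j = topmost T j"
    and free: "\<And>i j. (i, j) \<in> free_cells n S \<Longrightarrow> (i, j) \<in> S \<Longrightarrow> (i, j) \<in> T"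
  shows "S \<subseteq> T"
proof (intro subrelI)
  fix i j assume ij: "(i, j) \<in> S"
  then have b: "(i, j) \<in> board n" using S by (auto simp: fb_tableau_def)
  consider "j = leftmost S i" | "i = topmost S j" | "(i, j) \<in> free_cells n S"
    using leftmost_ge[OF S n ij] topmost_le[OF S n ij] b
    by (force simp: free_cells_iff[OF S n])
  then show "(i, j) \<in> T"
    using b ij l[of i] u[of j] leftmost_in[OF T n, of i] topmost_in[OF T n, of j] free
    by cases (auto simp: board_iff)
qed

section \<open>Partial order axioms\<close>

lemma fb_le_refl: "fb_le n T T"
  by (simp add: fb_le_def)

lemma fb_le_trans:
  assumes ST: "fb_le n S T" and TU: "fb_le n T U"
    and fb: "fb_tableau n S" "fb_tableau n T" "fb_tableau n U" and n: "n \<ge> 1"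
  shows "fb_le n S U"
proof -
  note ST' = ST[unfolded fb_le_iff[OF fb(1,2) n]] and TU' = TU[unfolded fb_le_iff[OF fb(2,3) n]]
  \<comment> \<open>Condition (3) chains through \<open>T\<close> because
    \<open>j < leftmost U i <= leftmost T i\<close> and
    \<open>topmost T j <= topmost S j < i\<close>.\<close>
  have "(i, j) \<in> free_cells n T" if "(i, j) \<in> free_cells n S" "(i, j) \<in> free_cells n U" for i j
    using that ST' TU' by (auto simp: free_cells_iff[OF _ n] fb board_iff intro: order.strict_trans1 order.strict_trans2)
  then show ?thesis using ST' TU' by (auto simp: fb_le_iff[OF fb(1,3) n] intro: order.trans)
qed

lemma fb_le_antisym:
  assumes ST: "fb_le n S T" and TS: "fb_le n T S"
    and fb: "fb_tableau n S" "fb_tableau n T" and n: "n \<ge> 1"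
  shows "S = T"
proof -
  note ST' = ST[unfolded fb_le_iff[OF fb(1,2) n]] and TS' = TS[unfolded fb_le_iff[OF fb(2,1) n]]
  have l: "leftmost S i = leftmost T i" if "1 \<le> i" "i \<le> n" for i
    using ST' TS' that by (simp add: order.antisym)
  have u: "topmost S j = topmost T j" if "1 \<le> j" "j \<le> n" for j
    using ST' TS' that by (simp add: order.antisym)
  have free: "(i, j) \<in> free_cells n S \<longleftrightarrow> (i, j) \<in> free_cells n T" for i j
    using l[of i] u[of j] by (auto simp: free_cells_iff[OF _ n] fb board_iff)
  show "S = T"
    using fb_tableau_subset[OF fb n l u] fb_tableau_subset[OF fb(2,1) n l[symmetric] u[symmetric]]
      ST' TS' free by blast
qed

section \<open>Joins\<close>

lemma free_cells_tableau_of: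
  assumes "arrow_system n l u" "n \<ge> 1"
  shows "(i, j) \<in> free_cells n (tableau_of n l u D) \<longleftrightarrow> (i, j) \<in> board n \<and> j < l i \<and> u j < i"
  using leftmost_tableau_of[OF assms, of i D] topmost_tableau_of[OF assms, of j D]
  by (auto simp: free_cells_iff[OF fb_tableau_tableau_of[OF assms] assms(2)] board_iff)

lemma free_in_tableau_of:
  assumes "arrow_system n l u" "n \<ge> 1" "(i, j) \<in> free_cells n (tableau_of n l u D)"
  shows "(i, j) \<in> tableau_of n l u D \<longleftrightarrow> i = j + 1 \<or> (i, j) \<in> D"
  using assms(3) unfolding free_cells_tableau_of[OF assms(1,2)] by (auto simp: tableau_of_def)

text \<open>Shows that the border dots forced by \<open>tableau_of\<close> never violate condition
  (3) and survive double complementation.\<close>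

lemma border_in_fb_tableau:
  assumes "fb_tableau n T" "n \<ge> 1" "(i, j) \<in> free_cells n T" "i = j + 1"
  shows "(i, j) \<in> T"
  using assms(1,3,4) unfolding fb_tableau_def
  by (auto simp: free_cells_iff[OF assms(1,2)] board_iff border_iff dest!: subsetD)

text \<open>The columns of left-arrows are forced to be the pointwise minimum; lowering \<open>l\<close> may push the
  left-arrow of a row onto or past an up-arrow of that row, which then has to move up to the next
  row where it still has something on its left.\<close>

lemma fb_join_exists:
  assumes S: "fb_tableau n S" and T: "fb_tableau n T" and n: "n \<ge> 1"
  shows "\<exists>J. fb_tableau n J \<and> fb_le n S J \<and> fb_le n T J \<and>
    (\<forall>U. fb_tableau n U \<and> fb_le n S U \<and> fb_le n T U \<longrightarrow> fb_le n J U)"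
proof -
  note AS = arrow_systemD[OF arrow_system_fb_tableau[OF S n]]
  note AT = arrow_systemD[OF arrow_system_fb_tableau[OF T n]]
  define l where "l i = min (leftmost S i) (leftmost T i)" for i
  define m where "m j = min (topmost S j) (topmost T j)" for j
  \<comment> \<open>The alternative \<open>i = 1\<close> keeps the set nonempty at
    \<open>j = n\<close>, where no row satisfies \<open>j < l i\<close>.\<close>
  define u where "u j = Max {i. 1 \<le> i \<and> i \<le> m j \<and> (i = 1 \<or> j < l i)}" for j
  \<comment> \<open>Each tableau contributes only its own free cells. An up-arrow of
    \<open>S\<close> or \<open>T\<close> may sit on a free cell of the join, but condition (3)
    transmits only dots, so that arrow alone must not create one.\<close>
  define D where "D = (S \<inter> free_cells n S) \<union> (T \<inter> free_cells n T)"
  let ?J = "tableau_of n l u D"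
  have l1: "l 1 = n" using AS(1) AT(1) by (simp add: l_def)
  have fin: "finite {i. 1 \<le> i \<and> i \<le> m j \<and> (i = 1 \<or> j < l i)}" for j
    by (rule finite_subset[of _ "{..m j}"]) auto
  have m: "1 \<le> m j" "m j \<le> j + 1" if "1 \<le> j" "j \<le> n" for j
    using AS(4)[OF that] AT(4)[OF that] by (auto simp: m_def)
  have u: "1 \<le> u j \<and> u j \<le> m j \<and> (u j = 1 \<or> j < l (u j))" if "1 \<le> j" "j \<le> n" for j
    using Max_in[OF fin[of j]] m(1)[OF that] unfolding u_def by blast
  have u_ge: "i \<le> u j" if "1 \<le> i" "i \<le> m j" "i = 1 \<or> j < l i" for i j
    unfolding u_def using that by (intro Max_ge[OF fin]) auto
  have lb: "i \<le> l i + 1 \<and> 1 \<le> l i \<and> l i \<le> n" if "1 \<le> i" "i \<le> n" for i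
    using AS(3)[OF that] AT(3)[OF that] by (auto simp: l_def)
  have ls: "arrow_system n l u"
    unfolding arrow_system_def
  proof (intro conjI allI impI)
    have "m n = 1" using AS(2) AT(2) by (simp add: m_def)
    then show "u n = 1" using u[of n] n by simp
  next
    fix i assume i: "2 \<le> i \<and> i \<le> n"
    \<comment> \<open>The minimum \<open>l i\<close> is attained by \<open>S\<close> or
      \<open>T\<close>, and admissibility of that tableau already bounds
      \<open>m (l i)\<close>.\<close>
    then have "m (l i) < i" using AS(5)[of i] AT(5)[of i] by (auto simp: m_def l_def min_def)
    then show "u (l i) < i" using u[of "l i"] lb[of i] i by simp
  next
    fix j assume j: "1 \<le> j \<and> j < n"
    then have "u j \<le> m j" "m j \<le> j + 1" using u[of j] m[of j] by auto
    then show "u j \<le> j + 1" by simp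
    show "j < l (u j)" using u[of j] j l1 by auto
  qed (use l1 lb u in auto)
  note J = fb_tableau_tableau_of[OF ls n, of D]
  have leS: "fb_le n S ?J"
    unfolding fb_le_iff[OF S J n]
    using leftmost_tableau_of[OF ls n] topmost_tableau_of[OF ls n] u free_in_tableau_of[OF ls n]
    by (auto simp: l_def m_def D_def)
  have leT: "fb_le n T ?J"
    unfolding fb_le_iff[OF T J n]
    using leftmost_tableau_of[OF ls n] topmost_tableau_of[OF ls n] u free_in_tableau_of[OF ls n]
    by (auto simp: l_def m_def D_def)
  have "fb_le n ?J U" if U: "fb_tableau n U" "fb_le n S U" "fb_le n T U" for U
  proof -
    note SU = U(2)[unfolded fb_le_iff[OF S U(1) n]] and TU = U(3)[unfolded fb_le_iff[OF T U(1) n]]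
    note AU = arrow_systemD[OF arrow_system_fb_tableau[OF U(1) n]]
    have lU: "leftmost U i \<le> l i" if "1 \<le> i" "i \<le> n" for i
      using SU TU that by (simp add: l_def)
    have uU: "topmost U j \<le> u j" if j: "1 \<le> j" "j \<le> n" for j
    proof (rule u_ge)
      show "1 \<le> topmost U j" using AU(4)[OF j] by simp
      show "topmost U j \<le> m j" using SU TU j by (simp add: m_def)
      \<comment> \<open>The row \<open>topmost U j\<close> competes in the maximum defining
        \<open>u j\<close>: admissibility of \<open>U\<close> puts \<open>j\<close> strictly below
        \<open>leftmost U\<close> in that row, hence below \<open>l\<close>. For
        \<open>j = n\<close> the row is 1.\<close>
      show "topmost U j = 1 \<or> j < l (topmost U j)"
      proof (cases "j = n")
        case False
        then have "j < leftmost U (topmost U j)" using AU(6) j by simp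
        then show ?thesis using lU[of "topmost U j"] AU(4)[OF j] by simp
      qed (use AU(2) in simp)
    qed
    \<comment> \<open>Such a cell is on the border, hence in \<open>U\<close>, or is a free nonempty
      cell of \<open>S\<close> or \<open>T\<close>, and condition (3) carries it into
      \<open>U\<close>.\<close>
    have "(i, j) \<in> U" if "(i, j) \<in> free_cells n ?J" "(i, j) \<in> free_cells n U" "(i, j) \<in> ?J" for i j
      using that free_in_tableau_of[OF ls n that(1)] border_in_fb_tableau[OF U(1) n that(2)] SU TU
      by (auto simp: D_def)
    then show ?thesis
      unfolding fb_le_iff[OF J U(1) n]
      using lU uU leftmost_tableau_of[OF ls n] topmost_tableau_of[OF ls n] by auto
  qed
  then show ?thesis using J leS leT by blast
qed

section \<open>Duality\<close>

text \<open>Reflecting the board along its diagonal exchanges left- and up-arrows, hence reverses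
  conditions (1) and (2). To reverse (3) as well, the free cells off the border (border cells are
  never empty) are complemented.\<close>

definition fb_dual :: "nat \<Rightarrow> cell set \<Rightarrow> cell set" where
  "fb_dual n T = tableau_of n (\<lambda>i. n + 1 - topmost T (n + 1 - i)) (\<lambda>j. n + 1 - leftmost T (n + 1 - j))
     {(i, j). (n + 1 - j, n + 1 - i) \<notin> T}"

text \<open>The reflection \<open>(i, j)\<close> to \<open>(n + 1 - j, n + 1 - i)\<close> exchanges
  rows with columns, and with them the two strict conditions on \<open>l\<close> and
  \<open>u\<close>.\<close>

lemma arrow_system_dual:
  assumes ls: "arrow_system n l u" and n: "n \<ge> 1"
  shows "arrow_system n (\<lambda>i. n + 1 - u (n + 1 - i)) (\<lambda>j. n + 1 - l (n + 1 - j))"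
proof -
  note A = arrow_systemD[OF ls]
  have "i \<le> n + 1 - u (n + 1 - i) + 1 \<and> n + 1 - u (n + 1 - i) \<le> n \<and>
    n + 1 - l (n + 1 - (n + 1 - u (n + 1 - i))) < i" if i: "2 \<le> i" "i \<le> n" for i
  proof -
    define j where "j = n + 1 - i"
    have j: "1 \<le> j" "j < n" "i = n + 1 - j" using i by (auto simp: j_def)
    \<comment> \<open>Truncated subtraction undoes itself here because
      \<open>u j <= n\<close>.\<close>
    have "n + 1 - (n + 1 - u j) = u j" using A(4)[of j] j by simp
    then show ?thesis using A(4,6)[of j] j unfolding j_def[symmetric] by auto
  qed
  moreover have "1 \<le> n + 1 - l (n + 1 - j) \<and> n + 1 - l (n + 1 - j) \<le> j + 1 \<and>
    j < n + 1 - u (n + 1 - (n + 1 - l (n + 1 - j)))" if j: "1 \<le> j" "j < n" for j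
  proof -
    define i where "i = n + 1 - j"
    have i: "2 \<le> i" "i \<le> n" "j = n + 1 - i" using j by (auto simp: i_def)
    have "n + 1 - (n + 1 - l i) = l i" using A(3)[of i] i by simp
    then show ?thesis using A(3,5)[of i] i unfolding i_def[symmetric] by auto
  qed
  ultimately show ?thesis
    using A(1,2) n unfolding arrow_system_def by auto
qed

lemma fb_dual:
  assumes T: "fb_tableau n T" and n: "n \<ge> 1"
  shows fb_tableau_dual: "fb_tableau n (fb_dual n T)"
    and leftmost_dual: "1 \<le> i \<Longrightarrow> i \<le> n \<Longrightarrow> leftmost (fb_dual n T) i = n + 1 - topmost T (n + 1 - i)"
    and topmost_dual: "1 \<le> j \<Longrightarrow> j \<le> n \<Longrightarrow> topmost (fb_dual n T) j = n + 1 - leftmost T (n + 1 - j)"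
    and free_cells_dual: "(i, j) \<in> free_cells n (fb_dual n T) \<longleftrightarrow>
      (i, j) \<in> board n \<and> (n + 1 - j, n + 1 - i) \<in> free_cells n T"
    and free_in_dual: "(i, j) \<in> free_cells n (fb_dual n T) \<Longrightarrow>
      (i, j) \<in> fb_dual n T \<longleftrightarrow> i = j + 1 \<or> (n + 1 - j, n + 1 - i) \<notin> T"
proof -
  note A = arrow_systemD(3,4)[OF arrow_system_fb_tableau[OF T n]]
  note ls = arrow_system_dual[OF arrow_system_fb_tableau[OF T n] n]
  show "fb_tableau n (fb_dual n T)"
    and "1 \<le> i \<Longrightarrow> i \<le> n \<Longrightarrow> leftmost (fb_dual n T) i = n + 1 - topmost T (n + 1 - i)"
    and "1 \<le> j \<Longrightarrow> j \<le> n \<Longrightarrow> topmost (fb_dual n T) j = n + 1 - leftmost T (n + 1 - j)"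
    unfolding fb_dual_def
    using fb_tableau_tableau_of[OF ls n] leftmost_tableau_of[OF ls n] topmost_tableau_of[OF ls n]
    by auto
  show "(i, j) \<in> free_cells n (fb_dual n T) \<longleftrightarrow>
      (i, j) \<in> board n \<and> (n + 1 - j, n + 1 - i) \<in> free_cells n T"
  proof (cases "(i, j) \<in> board n")
    case True
    then have b: "1 \<le> i" "i \<le> n" "1 \<le> j" "j \<le> n" "i \<le> j + 1" by (auto simp: board_iff)
    then have "1 \<le> leftmost T (n + 1 - j)" "topmost T (n + 1 - i) \<le> n"
      using A(1)[of "n + 1 - j"] A(2)[of "n + 1 - i"] by auto
    \<comment> \<open>Each of the two inequalities defining freeness becomes the other one for the
      reflected cell.\<close>
    then have "j < n + 1 - topmost T (n + 1 - i) \<longleftrightarrow> topmost T (n + 1 - i) < n + 1 - j"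
      "n + 1 - leftmost T (n + 1 - j) < i \<longleftrightarrow> n + 1 - i < leftmost T (n + 1 - j)"
      using b by linarith+
    then show ?thesis
      unfolding fb_dual_def free_cells_tableau_of[OF ls n] free_cells_iff[OF T n]
      using b by (simp add: board_iff) arith
  qed (use free_cells_tableau_of[OF ls n] in \<open>auto simp: fb_dual_def\<close>)
  show "(i, j) \<in> fb_dual n T \<longleftrightarrow> i = j + 1 \<or> (n + 1 - j, n + 1 - i) \<notin> T"
    if "(i, j) \<in> free_cells n (fb_dual n T)"
    using that free_in_tableau_of[OF ls n] unfolding fb_dual_def by auto
qed

lemma fb_dual_antimono:
  assumes S: "fb_tableau n S" and T: "fb_tableau n T" and n: "n \<ge> 1" and le: "fb_le n S T"
  shows "fb_le n (fb_dual n T) (fb_dual n S)"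
proof -
  note le' = le[unfolded fb_le_iff[OF S T n]]
  \<comment> \<open>Off the border, membership in a dual means absence of the reflected cell, so
    this is the contrapositive of condition (3) for \<open>S\<close> and \<open>T\<close>. On the
    border both duals are nonempty.\<close>
  have "(i, j) \<in> fb_dual n S" if "(i, j) \<in> free_cells n (fb_dual n T)"
    "(i, j) \<in> free_cells n (fb_dual n S)" "(i, j) \<in> fb_dual n T" for i j
    using that le' by (auto simp: free_in_dual[OF S n] free_in_dual[OF T n] free_cells_dual[OF S n]
        free_cells_dual[OF T n])
  then show ?thesis
    unfolding fb_le_iff[OF fb_tableau_dual[OF T n] fb_tableau_dual[OF S n] n]
  proof (intro conjI allI impI)
    fix i assume i: "1 \<le> i \<and> i \<le> n"
    then have "1 \<le> n + 1 - i \<and> n + 1 - i \<le> n" by auto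
    with i show "leftmost (fb_dual n S) i \<le> leftmost (fb_dual n T) i"
      using le'[THEN conjunct2, THEN conjunct1, rule_format, of "n + 1 - i"]
      by (simp add: leftmost_dual[OF S n] leftmost_dual[OF T n] diff_le_mono2)
  next
    fix j assume j: "1 \<le> j \<and> j \<le> n"
    then have "1 \<le> n + 1 - j \<and> n + 1 - j \<le> n" by auto
    with j show "topmost (fb_dual n S) j \<le> topmost (fb_dual n T) j"
      using le'[THEN conjunct1, rule_format, of "n + 1 - j"]
      by (simp add: topmost_dual[OF S n] topmost_dual[OF T n] diff_le_mono2)
  qed blast
qed

text \<open>Reflecting twice restores the arrows, and complementing twice restores the free cells
  off the border. On the border the dual always has a dot, and so does \<open>T\<close> at its free
  border cells.\<close>

lemma fb_dual_dual:
  assumes T: "fb_tableau n T" and n: "n \<ge> 1"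
  shows "fb_dual n (fb_dual n T) = T"
proof -
  note A = arrow_systemD(3,4)[OF arrow_system_fb_tableau[OF T n]]
  note T' = fb_tableau_dual[OF T n]
  note T'' = fb_tableau_dual[OF T' n]
  have l: "leftmost (fb_dual n (fb_dual n T)) i = leftmost T i" if "1 \<le> i" "i \<le> n" for i
    using A(1)[of i] that by (simp add: leftmost_dual[OF T' n] topmost_dual[OF T n])
  have u: "topmost (fb_dual n (fb_dual n T)) j = topmost T j" if "1 \<le> j" "j \<le> n" for j
    using A(2)[of j] that by (simp add: leftmost_dual[OF T n] topmost_dual[OF T' n])
  have free: "(i, j) \<in> free_cells n (fb_dual n (fb_dual n T)) \<longleftrightarrow> (i, j) \<in> free_cells n T" for i j
    by (auto simp: free_cells_dual[OF T' n] free_cells_dual[OF T n] free_cells_iff[OF T n] board_iff)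
  have mem: "(i, j) \<in> fb_dual n (fb_dual n T) \<longleftrightarrow> (i, j) \<in> T" if f: "(i, j) \<in> free_cells n T" for i j
  proof -
    have b: "1 \<le> i" "i \<le> n" "1 \<le> j" "j \<le> n" "i \<le> j + 1"
      using f by (auto simp: free_cells_iff[OF T n] board_iff)
    have f': "(n + 1 - j, n + 1 - i) \<in> free_cells n (fb_dual n T)"
      using f b by (auto simp: free_cells_dual[OF T n] board_iff)
    have "(i, j) \<in> fb_dual n (fb_dual n T) \<longleftrightarrow> i = j + 1 \<or> (n + 1 - j, n + 1 - i) \<notin> fb_dual n T"
      using free_in_dual[OF T' n] free f by simp
    also have "\<dots> \<longleftrightarrow> i = j + 1 \<or> (i, j) \<in> T"
      using free_in_dual[OF T n f'] b by auto
    also have "\<dots> \<longleftrightarrow> (i, j) \<in> T"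
      using border_in_fb_tableau[OF T n f] by auto
    finally show ?thesis .
  qed
  show ?thesis
    using fb_tableau_subset[OF T'' T n l u] fb_tableau_subset[OF T T'' n l[symmetric] u[symmetric]]
      free mem by blast
qed

text \<open>The converse direction is antimonotonicity once more, applied to the duals and
  simplified by the involution.\<close>

lemma fb_le_dual_iff:
  assumes S: "fb_tableau n S" and T: "fb_tableau n T" and n: "n \<ge> 1"
  shows "fb_le n (fb_dual n T) (fb_dual n S) \<longleftrightarrow> fb_le n S T"
  using fb_dual_antimono[OF S T n] fb_dual_dual[OF S n] fb_dual_dual[OF T n]
    fb_dual_antimono[OF fb_tableau_dual[OF T n] fb_tableau_dual[OF S n] n] by auto

section \<open>Meets, the lattice and its self-duality\<close>

lemma fb_meet_exists:
  assumes S: "fb_tableau n S" and T: "fb_tableau n T" and n: "n \<ge> 1"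
  shows "\<exists>M. fb_tableau n M \<and> fb_le n M S \<and> fb_le n M T \<and>
    (\<forall>U. fb_tableau n U \<and> fb_le n U S \<and> fb_le n U T \<longrightarrow> fb_le n U M)"
proof -
  note S' = fb_tableau_dual[OF S n] and T' = fb_tableau_dual[OF T n]
  \<comment> \<open>The meet will be \<open>fb_dual n J\<close>, with \<open>J\<close> the join of
    the two duals.\<close>
  obtain J where J: "fb_tableau n J" "fb_le n (fb_dual n S) J" "fb_le n (fb_dual n T) J"
    "\<And>U. fb_tableau n U \<Longrightarrow> fb_le n (fb_dual n S) U \<Longrightarrow> fb_le n (fb_dual n T) U \<Longrightarrow> fb_le n J U"
    using fb_join_exists[OF S' T' n] by blast
  have "fb_le n (fb_dual n J) S" "fb_le n (fb_dual n J) T"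
    using fb_dual_antimono[OF S' J(1) n J(2)] fb_dual_antimono[OF T' J(1) n J(3)]
    unfolding fb_dual_dual[OF S n] fb_dual_dual[OF T n] .
  moreover have "fb_le n U (fb_dual n J)" if "fb_tableau n U" "fb_le n U S" "fb_le n U T" for U
  proof -
    note U' = fb_tableau_dual[OF that(1) n]
    have "fb_le n J (fb_dual n U)"
      using J(4)[OF U'] fb_dual_antimono[OF that(1) S n that(2)] fb_dual_antimono[OF that(1) T n that(3)] .
    then show ?thesis
      using fb_dual_antimono[OF J(1) U' n] unfolding fb_dual_dual[OF that(1) n] by blast
  qed
  ultimately show ?thesis using fb_tableau_dual[OF J(1) n] by blast
qed

lemma lattice_fb_order:
  assumes n: "n \<ge> 1"
  shows "lattice (fb_order n)"
proof (unfold_locales)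
  fix S T assume "S \<in> carrier (fb_order n)" "T \<in> carrier (fb_order n)"
  then have ST: "fb_tableau n S" "fb_tableau n T" by (auto simp: fb_order_def)
  show "\<exists>s. least (fb_order n) s (Upper (fb_order n) {S, T})"
    using fb_join_exists[OF ST n] ST by (auto simp: least_def Upper_def fb_order_def)
  show "\<exists>s. greatest (fb_order n) s (Lower (fb_order n) {S, T})"
    using fb_meet_exists[OF ST n] ST by (auto simp: greatest_def Lower_def fb_order_def)
qed (use fb_le_refl fb_le_trans[OF _ _ _ _ _ n] fb_le_antisym[OF _ _ _ _ n]
    in \<open>force simp: fb_order_def\<close>)+

theorem theorem1p1:
  fixes n :: nat
  assumes "n \<ge> 1"
  shows "lattice (fb_order n) \<and> order_isomorphic (fb_order n) (inv_gorder (fb_order n))"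
proof
  interpret lattice "fb_order n" using lattice_fb_order[OF assms] .
  show "lattice (fb_order n)" by unfold_locales
  \<comment> \<open>Being an involution, \<open>fb_dual n\<close> is its own inverse on the
    tableaux.\<close>
  have "bij_betw (fb_dual n) {T. fb_tableau n T} {T. fb_tableau n T}"
    by (rule bij_betw_byWitness[where f' = "fb_dual n"])
      (use fb_dual_dual[OF _ assms] fb_tableau_dual[OF _ assms] in blast)+
  \<comment> \<open>Since \<open>inv_gorder\<close> swaps the arguments of the order, preserving and
    reflecting it amounts to \<open>fb_le_dual_iff\<close>.\<close>
  moreover have "order_emb (fb_order n) (inv_gorder (fb_order n)) (fb_dual n)"
    unfolding order_emb_def
    using weak_partial_order_axioms dual_weak_order fb_le_dual_iff[OF _ _ assms]
    by (simp add: fb_order_def)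
  ultimately show "order_isomorphic (fb_order n) (inv_gorder (fb_order n))"
    unfolding order_isomorphic_def by (auto simp: fb_order_def)
qed

end
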